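(* Let $n\ge 1$, let $\mathcal{L} \subset \mathbb{R}^{2n}$ be a Lagrangian subspace and $\mathbf{B} = (x_1, \ldots , x_n)$ some ordered basis of $\mathcal{L}$, and set $X = [\,x_1\;\cdots\;x_n\,]\in\mathbb{R}^{2n\times n}$. Let $\lambda_1, \ldots , \lambda_n\in\mathbb{C}$ be a collection of $n$ complex scalars (counted with multiplicity) that is closed under complex conjugation. Let $$p(x) := \prod_{k=1}^n (x- \lambda_k) = x^n + a_{n-1}x^{n-1} + \cdots + a_1x + a_0 \in \mathbb{R}[x]$$ and let $$C = \begin{bmatrix} 0 & \cdots & 0 & -a_0 \\ 1 & & \vdots & -a_1 \\ & \ddots & 0 & \vdots \\ 0 & & 1 & -a_{n-1} \end{bmatrix}\in\mathbb{R}^{n\times n}$$ be the companion matrix for $p(x)$, i.e. $Ce_k = e_{k+1}$ for $k=1,\ldots,n-1$ and $Ce_n = -(a_0,\ldots,a_{n-1})^T$. Let $X^{\bot} \in \mathbb{R}^{2n \times n}$ be a matrix whose columns are an orthonormal basis for the (Euclidean) orthogonal complement $\mathcal{L}^{\bot}$, and let $$\widetilde{H} = XCX^+ + J_{2n}^T(XCX^+)^TJ_{2n}\in \mathbb{R}^{2n \times 2n}.$$ Then any skew-Hamiltonian matrix $H \in \mathbb{HK}(\mathbf{B})$ such that the eigenvalues of $H|_{\mathcal{L}}$ are given by $\lambda_1, \ldots , \lambda_n$ (counted with multiplicity) can be expressed as $$H = \widetilde{H} + J_{2n}^TX^{\bot}S(X^{\bot})^T$$ where $S \in \mathbb{R}^{n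 \times n}$ is some skew-symmetric matrix.
   Context: $J_{2n} = \begin{bmatrix} 0 & I_n \\ -I_n & 0 \end{bmatrix} \in \mathbb{R}^{2n\times 2n}$. A subspace $\mathcal{L}\subset\mathbb{R}^{2n}$ is called isotropic if $x^TJ_{2n}y = 0$ for all $x,y\in\mathcal{L}$, and Lagrangian if it is isotropic and of dimension $n$. A matrix $H\in\mathbb{R}^{2n\times 2n}$ is called skew-Hamiltonian if $J_{2n}^TH^TJ_{2n} = H$. For an ordered basis $\mathbf{B}=(x_1,\ldots,x_n)$ of a Lagrangian subspace, $\mathbb{HK}(\mathbf{B})$ denotes the set of all skew-Hamiltonian matrices $H\in\mathbb{R}^{2n\times 2n}$ satisfying $Hx_k = x_{k+1}$ for all $k=1,\ldots,n-1$. For every $H\in\mathbb{HK}(\mathbf{B})$ the subspace $\mathcal{L}$ is $H$-invariant, and $H|_{\mathcal{L}}:\mathcal{L}\to\mathcal{L}$ denotes the restriction; its eigenvalues are the complex roots of its characteristic polynomial. $A^+$ denotes the Moore-Penrose pseudoinverse of $A$; $e_k$ is the $k$-th standard basis vector. *)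

theory Defs
  imports
    "Jordan_Normal_Form.Char_Poly"
    "Jordan_Normal_Form.VS_Connect"
    "HOL-Computational_Algebra.Fundamental_Theorem_Algebra"
begin

subsection \<open>Subspaces and ordered bases\<close>

abbreviation real_space :: "nat \<Rightarrow> (real, real vec) module" where
  "real_space m \<equiv> module_vec TYPE(real) m"

abbreviation linear_subspace :: "nat \<Rightarrow> real vec set \<Rightarrow> bool" where
  "linear_subspace m L \<equiv> VectorSpace.subspace class_ring L (real_space m)"

definition subspace_dim :: "nat \<Rightarrow> real vec set \<Rightarrow> nat" where
  "subspace_dim m L = vectorspace.dim class_ring ((real_space m)\<lparr>carrier := L\<rparr>)"

definition ordered_basis :: "nat \<Rightarrow> real vec set \<Rightarrow> real vec list \<Rightarrow> bool" where
  "ordered_basis m L xs \<longleftrightarrow>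
     distinct xs \<and> vectorspace.basis class_ring ((real_space m)\<lparr>carrier := L\<rparr>) (set xs)"

definition orthonormal :: "real vec list \<Rightarrow> bool" where
  "orthonormal ys \<longleftrightarrow>
     (\<forall>i < length ys. \<forall>j < length ys. ys ! i \<bullet> ys ! j = (if i = j then 1 else 0))"


subsection \<open>Symplectic notions\<close>

definition J_mat :: "nat \<Rightarrow> real mat" where
  "J_mat n = four_block_mat (0\<^sub>m n n) (1\<^sub>m n) (- 1\<^sub>m n) (0\<^sub>m n n)"

definition isotropic :: "nat \<Rightarrow> real vec set \<Rightarrow> bool" where
  "isotropic n L \<longleftrightarrow> linear_subspace (2 * n) L \<and>
     (\<forall>x \<in> L. \<forall>y \<in> L. x \<bullet> (J_mat n *\<^sub>v y) = 0)"

definition lagrangian :: "nat \<Rightarrow> real vec set \<Rightarrow> bool" where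
  "lagrangian n L \<longleftrightarrow> isotropic n L \<and> subspace_dim (2 * n) L = n"

definition skew_hamiltonian :: "nat \<Rightarrow> real mat \<Rightarrow> bool" where
  "skew_hamiltonian n H \<longleftrightarrow> H \<in> carrier_mat (2 * n) (2 * n) \<and>
     transpose_mat (J_mat n) * transpose_mat H * J_mat n = H"

definition HK :: "nat \<Rightarrow> real vec list \<Rightarrow> real mat set" where
  "HK n xs = {H. skew_hamiltonian n H \<and> (\<forall>k. Suc k < n \<longrightarrow> H *\<^sub>v (xs ! k) = xs ! Suc k)}"


subsection \<open>Companion matrix and Moore-Penrose pseudoinverse\<close>

definition companion_mat :: "nat \<Rightarrow> real poly \<Rightarrow> real mat" where
  "companion_mat n p = mat n n (\<lambda>(i, j).
     if j = n - 1 then - coeff p i else if i = Suc j then 1 else 0)"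

definition is_pseudoinverse :: "real mat \<Rightarrow> real mat \<Rightarrow> bool" where
  "is_pseudoinverse A P \<longleftrightarrow> P \<in> carrier_mat (dim_col A) (dim_row A) \<and>
     A * P * A = A \<and> P * A * P = P \<and>
     transpose_mat (A * P) = A * P \<and> transpose_mat (P * A) = P * A"

definition pseudoinverse :: "real mat \<Rightarrow> real mat" where
  "pseudoinverse A = (THE P. is_pseudoinverse A P)"

lemma pseudoinverse_eqI:
  assumes A: "A \<in> carrier_mat r c" and P: "is_pseudoinverse A P"
  shows "pseudoinverse A = P"
  unfolding pseudoinverse_def
proof (rule the_equality)
  show "is_pseudoinverse A P" by (rule P)
next
  fix Q assume Q: "is_pseudoinverse A Q"
  have Pc: "P \<in> carrier_mat c r" and Qc: "Q \<in> carrier_mat c r"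
    using A P Q by (auto simp: is_pseudoinverse_def)
  have p: "A * P * A = A" "P * A * P = P"
      "transpose_mat (A * P) = A * P" "transpose_mat (P * A) = P * A"
    and q: "A * Q * A = A" "Q * A * Q = Q"
      "transpose_mat (A * Q) = A * Q" "transpose_mat (Q * A) = Q * A"
    using P Q by (auto simp: is_pseudoinverse_def)
  have AP: "A * P = A * Q"
  proof -
    have "A * P = (A * Q) * (A * P)"
      using assoc_mult_mat[of "A * Q" r r A c P r] A Pc Qc q(1) by simp
    then have "A * P = transpose_mat ((A * Q) * (A * P))" using p(3) by simp
    also have "\<dots> = (A * P) * (A * Q)"
      using transpose_mult[of "A * Q" r r "A * P" r] A Pc Qc p(3) q(3) by simp
    also have "\<dots> = A * Q"
      using assoc_mult_mat[of "A * P" r r A c Q r] A Pc Qc p(1) by simp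
    finally show ?thesis .
  qed
  have PA: "P * A = Q * A"
  proof -
    have "P * A = (P * A) * (Q * A)"
      using assoc_mult_mat[of P c r A c "Q * A" c] assoc_mult_mat[of A r c Q r A c] A Pc Qc q(1)
      by simp
    then have "P * A = transpose_mat ((P * A) * (Q * A))" using p(4) by simp
    also have "\<dots> = (Q * A) * (P * A)"
      using transpose_mult[of "P * A" c c "Q * A" c] A Pc Qc p(4) q(4) by simp
    also have "\<dots> = Q * A"
      using assoc_mult_mat[of Q c r A c "P * A" c] assoc_mult_mat[of A r c P r A c] A Pc Qc p(1)
      by simp
    finally show ?thesis .
  qed
  have "Q = Q * (A * P)" using q(2) assoc_mult_mat[OF Qc A Qc] AP by simp
  also have "\<dots> = P" using p(2) assoc_mult_mat[OF Qc A Pc] PA by simp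
  finally show "Q = P" .
qed


subsection \<open>The eigenvalues of a matrix on an invariant subspace\<close>

text \<open>
  If \<open>L\<close> is invariant under \<open>H\<close> and \<open>B\<close> is the matrix whose columns are a basis of \<open>L\<close>, then
  \<open>H * B = B * M\<close> says that \<open>M\<close> represents the restriction of \<open>H\<close> to \<open>L\<close> in this basis.  The
  characteristic polynomial of \<open>M\<close> does not depend on the basis: see \<open>restr_char_poly_eqI\<close>.
\<close>

definition restr_char_poly :: "nat \<Rightarrow> real mat \<Rightarrow> real vec set \<Rightarrow> real poly" where
  "restr_char_poly m H L = (THE p. \<exists>bs M. ordered_basis m L bs \<and>
     M \<in> carrier_mat (length bs) (length bs) \<and>
     H * mat_of_cols m bs = mat_of_cols m bs * M \<and> p = char_poly M)"

definition restr_eigenvalues :: "nat \<Rightarrow> real mat \<Rightarrow> real vec set \<Rightarrow> complex multiset" where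
  "restr_eigenvalues m H L = proots (map_poly complex_of_real (restr_char_poly m H L))"

lemma ordered_basis_iff:
  assumes L: "linear_subspace m L"
  shows "ordered_basis m L xs \<longleftrightarrow> distinct xs \<and> set xs \<subseteq> L \<and>
    \<not> module.lin_dep class_ring (real_space m) (set xs) \<and>
    module.span class_ring (real_space m) (set xs) = L"
proof -
  interpret V: vec_space "TYPE(real)" m .
  interpret W: vectorspace class_ring "(real_space m)\<lparr>carrier := L\<rparr>"
    by (rule V.subspace_is_vs[OF L])
  have sub: "submodule class_ring L (real_space m)" using L by simp
  show ?thesis
    unfolding ordered_basis_def W.basis_def
    using V.span_li_not_depend[OF _ sub, of "set xs"] by auto
qed

lemma ordered_basis_length:
  assumes L: "linear_subspace m L" and xs: "ordered_basis m L xs"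
  shows "length xs = subspace_dim m L"
proof -
  interpret V: vec_space "TYPE(real)" m .
  interpret W: vectorspace class_ring "(real_space m)\<lparr>carrier := L\<rparr>"
    by (rule V.subspace_is_vs[OF L])
  show ?thesis
    using xs W.dim_basis[of "set xs"] distinct_card[of xs]
    unfolding ordered_basis_def subspace_dim_def by auto
qed

lemma ordered_basis_coords:
  assumes L: "linear_subspace m L" and xs: "ordered_basis m L xs"
  shows "set xs \<subseteq> carrier_vec m"
    and "v \<in> L \<Longrightarrow> \<exists>c \<in> carrier_vec (length xs). mat_of_cols m xs *\<^sub>v c = v"
    and "c \<in> carrier_vec (length xs) \<Longrightarrow> mat_of_cols m xs *\<^sub>v c = 0\<^sub>v m \<Longrightarrow>
      c = 0\<^sub>v (length xs)"
proof -
  interpret V: vec_space "TYPE(real)" m .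
  from xs[unfolded ordered_basis_iff[OF L]]
  have dist: "distinct xs" and sub: "set xs \<subseteq> L" and li: "\<not> V.lin_dep (set xs)"
    and span: "V.span (set xs) = L" by auto
  have "L \<subseteq> carrier_vec m" using L submodule.subset[of class_ring L "real_space m"] by simp
  with sub show car: "set xs \<subseteq> carrier_vec m" by auto
  then have dims: "\<forall>w \<in> set xs. dim_vec w = m" by auto
  have lc: "V.lincomb f (set xs) = mat_of_cols m xs *\<^sub>v vec (length xs) (\<lambda>i. f (xs ! i))" for f
    using V.lincomb_as_lincomb_list_distinct[OF car dist]
      V.lincomb_list_as_mat_mult[OF dims] by simp
  show "\<exists>c \<in> carrier_vec (length xs). mat_of_cols m xs *\<^sub>v c = v" if "v \<in> L"
  proof -
    from that V.finite_span[OF finite_set car] span obtain f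
      where "v = V.lincomb f (set xs)" by auto
    then show ?thesis unfolding lc by (intro bexI[OF _ vec_carrier]) auto
  qed
  show "c = 0\<^sub>v (length xs)"
    if c: "c \<in> carrier_vec (length xs)" and 0: "mat_of_cols m xs *\<^sub>v c = 0\<^sub>v m"
  proof (rule ccontr)
    assume "c \<noteq> 0\<^sub>v (length xs)"
    then obtain i where i: "i < length xs" "c $ i \<noteq> 0" using c by (auto simp: vec_eq_iff)
    define f where "f x = c $ (THE j. j < length xs \<and> xs ! j = x)" for x
    have f: "f (xs ! j) = c $ j" if "j < length xs" for j
      unfolding f_def using that dist
      by (intro arg_cong[where f = "\<lambda>j. c $ j"] the_equality) (auto simp: nth_eq_iff_index_eq)
    have "vec (length xs) (\<lambda>i. f (xs ! i)) = c" using c f by auto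
    then have "V.lincomb f (set xs) = 0\<^sub>v m" using lc 0 by simp
    then have "V.lin_dep (set xs)"
      unfolding V.lin_dep_def using i f
      by (intro exI[of _ "set xs"] exI[of _ f] exI[of _ "xs ! i"]) auto
    then show False using li by blast
  qed
qed

lemma mat_mult_left_cancel:
  fixes B :: "real mat"
  assumes B: "B \<in> carrier_mat m r" and inj: "\<And>c. c \<in> carrier_vec r \<Longrightarrow> B *\<^sub>v c = 0\<^sub>v m \<Longrightarrow> c = 0\<^sub>v r"
    and M: "M \<in> carrier_mat r k" and N: "N \<in> carrier_mat r k" and eq: "B * M = B * N"
  shows "M = N"
proof (rule eq_matI)
  fix i j assume ij: "i < dim_row N" "j < dim_col N"
  have c: "col M j \<in> carrier_vec r" "col N j \<in> carrier_vec r" using M N by auto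
  have "B *\<^sub>v col M j = B *\<^sub>v col N j"
    using eq ij B M N by (metis carrier_matD(2) col_mult2)
  then have "B *\<^sub>v (col M j - col N j) = 0\<^sub>v m"
    using B c by (simp add: mult_minus_distrib_mat_vec)
  then have "col M j - col N j = 0\<^sub>v r" using inj c by auto
  then have "(col M j - col N j) $ i = 0" using ij N by simp
  then show "M $$ (i, j) = N $$ (i, j)" using ij M N by auto
qed (use M N in auto)

lemma restr_char_poly_eqI:
  assumes L: "linear_subspace m L" and H: "H \<in> carrier_mat m m"
    and xs: "ordered_basis m L xs" and M: "M \<in> carrier_mat (length xs) (length xs)"
    and HM: "H * mat_of_cols m xs = mat_of_cols m xs * M"
  shows "restr_char_poly m H L = char_poly M"
  unfolding restr_char_poly_def
proof (rule the_equality)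
  show "\<exists>bs M'. ordered_basis m L bs \<and> M' \<in> carrier_mat (length bs) (length bs) \<and>
     H * mat_of_cols m bs = mat_of_cols m bs * M' \<and> char_poly M = char_poly M'"
    using assms by blast
next
  fix p assume "\<exists>bs M. ordered_basis m L bs \<and> M \<in> carrier_mat (length bs) (length bs) \<and>
     H * mat_of_cols m bs = mat_of_cols m bs * M \<and> p = char_poly M"
  then obtain ys N where ys: "ordered_basis m L ys"
    and N: "N \<in> carrier_mat (length ys) (length ys)"
    and HN: "H * mat_of_cols m ys = mat_of_cols m ys * N" and p: "p = char_poly N" by blast
  define r where "r = length xs"
  have len: "length ys = r"
    using ordered_basis_length[OF L xs] ordered_basis_length[OF L ys] by (simp add: r_def)
  have ex: "\<exists>Q \<in> carrier_mat r r. mat_of_cols m b = mat_of_cols m a * Q"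
    if a: "ordered_basis m L a" and b: "ordered_basis m L b" and la: "length a = r"
      and lb: "length b = r" for a b
  proof -
    have bL: "set b \<subseteq> L" using b ordered_basis_iff[OF L] by blast
    have "\<forall>j. \<exists>c. j < r \<longrightarrow> c \<in> carrier_vec r \<and> mat_of_cols m a *\<^sub>v c = b ! j"
      using ordered_basis_coords(2)[OF L a] bL la lb by (metis nth_mem subsetD)
    then obtain c where c: "\<And>j. j < r \<Longrightarrow> c j \<in> carrier_vec r"
      "\<And>j. j < r \<Longrightarrow> mat_of_cols m a *\<^sub>v c j = b ! j" by metis
    define Q where "Q = mat_of_cols r (map c [0..<r])"
    have Q: "Q \<in> carrier_mat r r" unfolding Q_def using mat_of_cols_carrier(1)[of r "map c [0..<r]"] by simp
    have A: "mat_of_cols m a \<in> carrier_mat m r" using mat_of_cols_carrier(1)[of m a] la by simp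
    have bc: "set b \<subseteq> carrier_vec m" by (rule ordered_basis_coords(1)[OF L b])
    have "mat_of_cols m b = mat_of_cols m a * Q"
    proof (rule mat_col_eqI)
      fix j assume "j < dim_col (mat_of_cols m a * Q)"
      then have j: "j < r" using Q by simp
      have "col (mat_of_cols m a * Q) j = mat_of_cols m a *\<^sub>v col Q j"
        by (rule col_mult2[OF A Q j])
      also have "col Q j = c j" using c j by (simp add: Q_def)
      finally show "col (mat_of_cols m b) j = col (mat_of_cols m a * Q) j"
        using c j lb bc by (simp add: subset_iff)
    qed (use A Q lb in auto)
    with Q show ?thesis by blast
  qed
  define A where "A = mat_of_cols m xs"
  define B where "B = mat_of_cols m ys"
  have A: "A \<in> carrier_mat m r" and B: "B \<in> carrier_mat m r"
    using mat_of_cols_carrier(1)[of m xs] mat_of_cols_carrier(1)[of m ys] len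
    by (simp_all add: A_def B_def r_def)
  obtain Q where Q: "Q \<in> carrier_mat r r" and BQ: "B = A * Q"
    using ex[OF xs ys r_def[symmetric] len, folded A_def B_def] by blast
  obtain P where P: "P \<in> carrier_mat r r" and AP: "A = B * P"
    using ex[OF ys xs len r_def[symmetric], folded A_def B_def] by blast
  note M = M[folded r_def] and N = N[unfolded len]
  note injA = ordered_basis_coords(3)[OF L xs, folded r_def A_def]
  note injB = ordered_basis_coords(3)[OF L ys, folded B_def, unfolded len]
  have "A * (Q * P) = A * 1\<^sub>m r"
    using assoc_mult_mat[OF A Q P, folded BQ, folded AP] right_mult_one_mat[OF A] by metis
  then have QP: "Q * P = 1\<^sub>m r" using mat_mult_left_cancel[OF A injA, of "Q * P" r "1\<^sub>m r"] P Q by simp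
  have "B * (P * Q) = B * 1\<^sub>m r"
    using assoc_mult_mat[OF B P Q, folded AP, folded BQ] right_mult_one_mat[OF B] by metis
  then have PQ: "P * Q = 1\<^sub>m r" using mat_mult_left_cancel[OF B injB, of "P * Q" r "1\<^sub>m r"] P Q by simp
  have "B * N = H * (A * Q)" using HN BQ by (simp add: B_def)
  also have "\<dots> = A * M * Q" using HM[folded A_def] assoc_mult_mat[OF H A Q] by simp
  also have "\<dots> = B * (P * M * Q)"
  proof -
    have "A * M * Q = B * P * M * Q" using arg_cong[OF AP, of "\<lambda>A. A * M * Q"] .
    then show ?thesis
      using assoc_mult_mat[OF B P M] assoc_mult_mat[OF B _ Q, of "P * M"] P M by simp
  qed
  finally have "N = P * M * Q" using mat_mult_left_cancel[OF B injB N, of "P * M * Q"] P M Q by simp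
  then have "similar_mat N M" using similar_matI[of N M P Q r] P Q M N PQ QP by simp
  then show "p = char_poly M" using p char_poly_similar by blast
qed

end

theory Submission
  imports Defs
begin

text \<open>
  \<open>H\<close> is skew-Hamiltonian iff \<open>J H\<close> is skew-symmetric.  The shift property and isotropy then give
  \<open>X\<^sup>T J H X = 0\<close>, so \<open>L\<close> is \<open>H\<close>-invariant and \<open>H X = X M\<close>, where \<open>M\<close> is a companion matrix by the
  shift property and equals \<open>C\<close> by its eigenvalues.  Since also \<open>Htilde X = X C\<close>, the skew-symmetric
  matrix \<open>D = J (H - Htilde)\<close> vanishes on \<open>L\<close>, hence is fixed by multiplication on either side with
  the projection \<open>Q Q\<^sup>T\<close> onto the orthogonal complement (\<open>Q = Xperp\<close>), and \<open>S = Q\<^sup>T D Q\<close> works.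
\<close>

subsection \<open>Matrix algebra\<close>

text \<open>The \<open>_dim\<close> variants replace carrier conditions, whose dimensions occur only
  in the premises, by equations between dimensions that the simplifier can discharge itself.\<close>

lemma assoc_mult_mat_dim:
  fixes A B C :: "'a :: semiring_0 mat"
  shows "dim_col A = dim_row B \<Longrightarrow> dim_col B = dim_row C \<Longrightarrow> A * B * C = A * (B * C)"
  by (rule assoc_mult_mat[of A "dim_row A" "dim_col A" B "dim_col B" C "dim_col C"]) auto

lemma transpose_mult_dim:
  fixes A B :: "'a :: comm_semiring_0 mat"
  shows "dim_col A = dim_row B \<Longrightarrow> transpose_mat (A * B) = transpose_mat B * transpose_mat A"
  by (rule transpose_mult[of A "dim_row A" "dim_col A" B "dim_col B"]) auto

lemma mult_add_distrib_mat_dim: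
  fixes A B C :: "'a :: semiring_0 mat"
  shows "dim_col A = dim_row B \<Longrightarrow> dim_row B = dim_row C \<Longrightarrow> dim_col B = dim_col C \<Longrightarrow>
    A * (B + C) = A * B + A * C"
  by (rule mult_add_distrib_mat[of A "dim_row A" "dim_col A" B "dim_col B" C]) auto

lemma add_mult_distrib_mat_dim:
  fixes A B C :: "'a :: semiring_0 mat"
  shows "dim_col A = dim_row C \<Longrightarrow> dim_row A = dim_row B \<Longrightarrow> dim_col A = dim_col B \<Longrightarrow>
    (A + B) * C = A * C + B * C"
  by (rule add_mult_distrib_mat[of A "dim_row A" "dim_col A" B C "dim_col C"]) auto

lemma mult_minus_distrib_mat_dim:
  fixes A B C :: "'a :: ring mat"
  shows "dim_col A = dim_row B \<Longrightarrow> dim_row B = dim_row C \<Longrightarrow> dim_col B = dim_col C \<Longrightarrow>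
    A * (B - C) = A * B - A * C"
  by (rule mult_minus_distrib_mat[of A "dim_row A" "dim_col A" B "dim_col B" C]) auto

lemma minus_mult_distrib_mat_dim:
  fixes A B C :: "'a :: ring mat"
  shows "dim_col A = dim_row C \<Longrightarrow> dim_row A = dim_row B \<Longrightarrow> dim_col A = dim_col B \<Longrightarrow>
    (A - B) * C = A * C - B * C"
  by (rule minus_mult_distrib_mat[of A "dim_row A" "dim_col A" B C "dim_col C"]) auto

lemma uminus_mult_left_mat_dim:
  fixes A B :: "'a :: ring mat"
  shows "dim_col A = dim_row B \<Longrightarrow> - A * B = - (A * B)"
  by (rule uminus_mult_left_mat) auto

lemma uminus_mult_right_mat_dim:
  fixes A B :: "'a :: ring mat"
  shows "dim_col A = dim_row B \<Longrightarrow> A * - B = - (A * B)"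
  by (rule uminus_mult_right_mat) auto

lemma zero_mult_mat_dim:
  fixes A :: "'a :: semiring_0 mat"
  shows "k = dim_row A \<Longrightarrow> 0\<^sub>m m k * A = 0\<^sub>m m (dim_col A)"
  by (rule left_mult_zero_mat) auto

lemma mult_zero_mat_dim:
  fixes A :: "'a :: semiring_0 mat"
  shows "k = dim_col A \<Longrightarrow> A * 0\<^sub>m k m = 0\<^sub>m (dim_row A) m"
  by (rule right_mult_zero_mat) auto

lemma one_mult_mat_dim:
  fixes A :: "'a :: semiring_1 mat"
  shows "k = dim_row A \<Longrightarrow> 1\<^sub>m k * A = A"
  by (rule left_mult_one_mat) auto

lemma mult_one_mat_dim:
  fixes A :: "'a :: semiring_1 mat"
  shows "k = dim_col A \<Longrightarrow> A * 1\<^sub>m k = A"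
  by (rule right_mult_one_mat) auto

lemma add_zero_mat_dim:
  fixes A :: "'a :: monoid_add mat"
  shows "m = dim_row A \<Longrightarrow> k = dim_col A \<Longrightarrow> A + 0\<^sub>m m k = A"
    and "m = dim_row A \<Longrightarrow> k = dim_col A \<Longrightarrow> 0\<^sub>m m k + A = A"
  by auto

text \<open>Drives expressions to a normal form: sums expanded, products nested to the right,
  transposes pushed to the factors and signs pulled out.\<close>

lemmas mat_dim_simps = assoc_mult_mat_dim transpose_mult_dim mult_add_distrib_mat_dim
  add_mult_distrib_mat_dim mult_minus_distrib_mat_dim minus_mult_distrib_mat_dim
  uminus_mult_left_mat_dim uminus_mult_right_mat_dim zero_mult_mat_dim mult_zero_mat_dim
  one_mult_mat_dim mult_one_mat_dim add_zero_mat_dim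

lemma obtain_inverse_mat:
  fixes A :: "'a :: field mat"
  assumes A: "A \<in> carrier_mat n n" and det: "det A \<noteq> 0"
  obtains B where "B \<in> carrier_mat n n" "A * B = 1\<^sub>m n" "B * A = 1\<^sub>m n"
  using det_non_zero_imp_unit[OF A det, of "()"] by (auto simp: Units_def ring_mat_simps)

lemma det_nonzero_if_injective:
  fixes A :: "'a :: field mat"
  assumes A: "A \<in> carrier_mat n n"
    and inj: "\<And>c. c \<in> carrier_vec n \<Longrightarrow> A *\<^sub>v c = 0\<^sub>v n \<Longrightarrow> c = 0\<^sub>v n"
  shows "det A \<noteq> 0"
  using det_0_iff_vec_prod_zero[OF A] inj by blast

lemma scalar_prod_self_eq_0:
  fixes v :: "real vec"
  assumes "v \<in> carrier_vec m" "v \<bullet> v = 0"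
  shows "v = 0\<^sub>v m"
  using assms by (auto simp: scalar_prod_def sum_nonneg_eq_0_iff)

text \<open>The Gram matrix \<open>G = A^T A\<close> is invertible: \<open>G c = 0\<close> gives
  \<open>|A c|^2 = (G c) . c = 0\<close>, hence \<open>c = 0\<close>. Then \<open>G^-1 A^T\<close>
  satisfies the Penrose equations and is a left inverse of \<open>A\<close>.\<close>

lemma pseudoinverse_full_column_rank:
  assumes A: "A \<in> carrier_mat m r"
    and inj: "\<And>c. c \<in> carrier_vec r \<Longrightarrow> A *\<^sub>v c = 0\<^sub>v m \<Longrightarrow> c = 0\<^sub>v r"
  shows "is_pseudoinverse A (pseudoinverse A)" "pseudoinverse A * A = 1\<^sub>m r"
proof -
  define G where "G = transpose_mat A * A"
  have G: "G \<in> carrier_mat r r" using A by (simp add: G_def)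
  have "det G \<noteq> 0"
  proof (rule det_nonzero_if_injective[OF G])
    fix c :: "real vec" assume c: "c \<in> carrier_vec r" and Gc: "G *\<^sub>v c = 0\<^sub>v r"
    have Ac: "A *\<^sub>v c \<in> carrier_vec m" using A c by (rule mult_mat_vec_carrier)
    have "G *\<^sub>v c = transpose_mat A *\<^sub>v (A *\<^sub>v c)"
      unfolding G_def by (rule assoc_mult_mat_vec[of _ r m _ r]) (use A c in auto)
    then have "(A *\<^sub>v c) \<bullet> (A *\<^sub>v c) = (G *\<^sub>v c) \<bullet> c"
      using transpose_vec_mult_scalar[OF A c Ac] by simp
    also have "\<dots> = 0" using Gc c by simp
    finally show "c = 0\<^sub>v r" using scalar_prod_self_eq_0[OF Ac] inj[OF c] by simp
  qed
  then obtain B where B: "B \<in> carrier_mat r r" and GB: "G * B = 1\<^sub>m r" and BG: "B * G = 1\<^sub>m r"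
    using obtain_inverse_mat[OF G] by blast
  have dims: "dim_row A = m" "dim_col A = r" "dim_row B = r" "dim_col B = r"
    "dim_row G = r" "dim_col G = r"
    using A B G by auto
  have GT: "transpose_mat G = G" by (simp add: G_def mat_dim_simps)
  \<comment> \<open>The transpose of \<open>B\<close> is a left inverse of the symmetric
    \<open>G\<close>, so it equals the right inverse \<open>B\<close>. This makes
    \<open>A * B * A^T\<close> symmetric, as the Penrose equations demand.\<close>
  have BT: "transpose_mat B = B"
  proof -
    have "transpose_mat B * G = 1\<^sub>m r"
      using arg_cong[OF GB, of transpose_mat] GT dims by (simp add: mat_dim_simps)
    then have "transpose_mat B * G * B = B" using dims by (simp add: mat_dim_simps)
    then show ?thesis using GB dims by (simp add: mat_dim_simps)
  qed
  have PA: "B * transpose_mat A * A = 1\<^sub>m r"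
    using BG dims by (simp add: G_def mat_dim_simps)
  have "is_pseudoinverse A (B * transpose_mat A)"
    unfolding is_pseudoinverse_def using PA BT dims A B
    by (simp add: mat_dim_simps)
  moreover from this have "pseudoinverse A = B * transpose_mat A"
    by (rule pseudoinverse_eqI[OF A])
  ultimately show "is_pseudoinverse A (pseudoinverse A)" "pseudoinverse A * A = 1\<^sub>m r"
    using PA by simp_all
qed

subsection \<open>Orthogonal complements\<close>

text \<open>Makes the facts about ordered bases, which presuppose a subspace, available for the
  columns of \<open>Xperp\<close>.\<close>

lemma orthogonal_complement_subspace:
  assumes "L \<subseteq> carrier_vec m"
  shows "linear_subspace m (vec_module.orthogonal_complement m L)"
proof -
  interpret V: vec_space "TYPE(real)" m .
  have "submodule class_ring (V.orthogonal_complement L) (real_space m)"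
    using assms
    by (intro submodule.intro V.module_axioms)
      (auto simp: V.orthogonal_complement_def module_vec_simps class_field_def
        add_scalar_prod_distrib[where n = m] subset_iff)
  then show ?thesis by (simp add: V.vectorspace_axioms subspace_def)
qed

lemma orthonormal_cols:
  assumes Q: "Q \<in> carrier_mat m r" and on: "orthonormal (cols Q)"
  shows "transpose_mat Q * Q = 1\<^sub>m r"
  using assms by (intro eq_matI) (auto simp: orthonormal_def)

text \<open>\<open>X * pseudoinverse X\<close> and \<open>Q * Q^T\<close> are the orthogonal
  projections onto \<open>L\<close> and its complement. The third claim is proved before the second,
  which applies it to \<open>1 - X * pseudoinverse X\<close>.\<close>

lemma projections_onto_complements:
  assumes L: "linear_subspace m L" and xs: "ordered_basis m L xs"
    and X: "X = mat_of_cols m xs"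
    and Q: "Q \<in> carrier_mat m r"
    and perp: "ordered_basis m (vec_module.orthogonal_complement m L) (cols Q)"
    and on: "orthonormal (cols Q)"
  shows "transpose_mat Q * X = 0\<^sub>m r (length xs)"
    and "X * pseudoinverse X + Q * transpose_mat Q = 1\<^sub>m m"
    and "\<And>B k. B \<in> carrier_mat m k \<Longrightarrow> transpose_mat X * B = 0\<^sub>m (length xs) k \<Longrightarrow>
      B = Q * (transpose_mat Q * B)"
proof -
  define s where "s = length xs"
  interpret V: vec_space "TYPE(real)" m .
  have LV: "L \<subseteq> carrier_vec m" using L submodule.subset[of class_ring L "real_space m"] by simp
  have Lperp: "linear_subspace m (V.orthogonal_complement L)"
    by (rule orthogonal_complement_subspace[OF LV])
  have Xc: "X \<in> carrier_mat m s" by (simp add: X s_def)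
  have xsL: "set xs \<subseteq> L" and colsQ: "set (cols Q) \<subseteq> V.orthogonal_complement L"
    using xs perp ordered_basis_iff[OF L] ordered_basis_iff[OF Lperp] by blast+
  have QQ: "mat_of_cols m (cols Q) = Q" and lQ: "length (cols Q) = r"
    using Q by auto
  have colX: "col X j = xs ! j" "xs ! j \<in> L" if "j < s" for j
    using that xsL LV by (auto simp: X s_def subset_iff)
  have colQ: "col Q i \<in> V.orthogonal_complement L" if "i < r" for i
    using colsQ that lQ Q by (metis carrier_matD(2) cols_length cols_nth nth_mem subsetD)
  note inj = ordered_basis_coords(3)[OF L xs, folded X s_def]
  show QX: "transpose_mat Q * X = 0\<^sub>m r (length xs)"
    unfolding s_def[symmetric]
    using Q Xc colX colQ by (intro eq_matI) (auto simp: V.orthogonal_complement_def)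
  define P where "P = pseudoinverse X"
  have P: "P \<in> carrier_mat s m" "transpose_mat (X * P) = X * P" and PX: "P * X = 1\<^sub>m s"
    using pseudoinverse_full_column_rank[OF Xc inj] Xc by (auto simp: is_pseudoinverse_def P_def)
  note Q1 = orthonormal_cols[OF Q on]
  have dims: "dim_row X = m" "dim_col X = s" "dim_row P = s" "dim_col P = m"
    "dim_row Q = m" "dim_col Q = r"
    using Xc P Q by auto
  show key: "B = Q * (transpose_mat Q * B)"
    if B: "B \<in> carrier_mat m k" and XB: "transpose_mat X * B = 0\<^sub>m (length xs) k" for B k
  proof (rule mat_col_eqI)
    fix j assume "j < dim_col (Q * (transpose_mat Q * B))"
    then have j: "j < k" using B by simp
    define b where "b = col B j"
    have b: "b \<in> carrier_vec m" using B by (auto simp: b_def)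
    have xb: "xs ! i \<bullet> b = 0" if i: "i < s" for i
      using arg_cong[OF XB, of "\<lambda>M. M $$ (i, j)"] i j B Xc colX[OF i] by (simp add: s_def b_def)
    have "b \<in> V.orthogonal_complement L"
      unfolding V.orthogonal_complement_def
    proof (intro CollectI conjI ballI b)
      fix y assume "y \<in> L"
      then obtain c where c: "c \<in> carrier_vec s" and y: "X *\<^sub>v c = y"
        using ordered_basis_coords(2)[OF L xs] by (auto simp: X s_def)
      have "transpose_mat X *\<^sub>v b = 0\<^sub>v s"
        using xb colX Xc by (intro eq_vecI) auto
      then show "b \<bullet> y = 0" using transpose_vec_mult_scalar[OF Xc c b] c y by simp
    qed
    \<comment> \<open>Orthonormality recovers the coordinates as \<open>w = Q^T b\<close>, so
      \<open>Q * Q^T\<close> fixes the column \<open>b\<close>.\<close>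
    then obtain w where w: "w \<in> carrier_vec r" and bw: "Q *\<^sub>v w = b"
      using ordered_basis_coords(2)[OF Lperp perp] QQ lQ by auto
    have "transpose_mat Q *\<^sub>v b = w"
      using assoc_mult_mat_vec[of "transpose_mat Q" r m Q r w] Q1 Q w bw by simp
    then have "Q *\<^sub>v (transpose_mat Q *\<^sub>v b) = b" using bw by simp
    moreover have "col (Q * (transpose_mat Q * B)) j = Q *\<^sub>v col (transpose_mat Q * B) j"
      by (rule col_mult2[of _ m r _ k]) (use Q B j in auto)
    moreover have "col (transpose_mat Q * B) j = transpose_mat Q *\<^sub>v b"
      unfolding b_def by (rule col_mult2[of _ r m _ k]) (use Q B j in auto)
    ultimately show "col B j = col (Q * (transpose_mat Q * B)) j" by (simp add: b_def)
  qed (use B Q in auto)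
  have QXP: "transpose_mat Q * (X * P) = 0\<^sub>m r m"
  proof -
    have "transpose_mat Q * (X * P) = transpose_mat Q * X * P"
      using dims by (simp add: mat_dim_simps)
    then show ?thesis using QX dims by (simp add: s_def mat_dim_simps)
  qed
  have XXP: "transpose_mat X * (X * P) = transpose_mat X"
  proof -
    have "transpose_mat X * (X * P) = transpose_mat X * transpose_mat (X * P)" using P by simp
    also have "\<dots> = transpose_mat (X * P * X)" using dims by (simp add: mat_dim_simps)
    also have "X * P * X = X" using PX dims by (simp add: mat_dim_simps)
    finally show ?thesis .
  qed
  \<comment> \<open>The complementary projection: \<open>X^T\<close> annihilates it, so
    \<open>key\<close> gives \<open>R = Q * (Q^T * R)\<close>, and \<open>Q^T * R\<close> is just
    \<open>Q^T\<close> because \<open>Q^T * X = 0\<close>.\<close>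
  define R where "R = 1\<^sub>m m - X * P"
  have Rc: "R \<in> carrier_mat m m" using dims by (auto simp: R_def)
  have "transpose_mat X * R = 0\<^sub>m s m"
    using XXP dims minus_r_inv_mat[of "transpose_mat X" s m] Xc by (simp add: R_def mat_dim_simps)
  then have "R = Q * (transpose_mat Q * R)" using key[OF Rc] by (simp add: s_def)
  also have "transpose_mat Q * R = transpose_mat Q"
    using QXP dims by (auto simp: R_def mat_dim_simps intro: eq_matI)
  finally have "X * P + Q * transpose_mat Q = X * P + R" by simp
  also have "\<dots> = 1\<^sub>m m" using dims by (intro eq_matI) (auto simp: R_def)
  finally show "X * pseudoinverse X + Q * transpose_mat Q = 1\<^sub>m m" by (simp add: P_def)
qed


subsection \<open>Companion matrices\<close>

text \<open>Adding \<open>x^k\<close> times row \<open>k\<close> to row 0 of the characteristic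
  matrix, for all \<open>k > 0\<close>, leaves only \<open>p\<close> in the last position of row 0.
  Laplace expansion along this row then gives \<open>p\<close> times one cofactor.\<close>

lemma char_poly_companion_mat:
  assumes n: "n \<ge> 1" and deg: "degree p = n" and monic: "lead_coeff p = 1"
  shows "char_poly (companion_mat n p) = p"
proof -
  define x :: "real poly" where "x = [:0, 1:]"
  define B where "B = char_poly_matrix (companion_mat n p)"
  have Bc: "B \<in> carrier_mat n n" by (simp add: B_def companion_mat_def)
  have B: "B $$ (i, j) = (if i = j then x else 0)
      + (if j = n - 1 then [:coeff p i:] else if i = Suc j then - 1 else 0)"
    if "i < n" "j < n" for i j
    using that by (simp add: B_def char_poly_matrix_def companion_mat_def x_def one_pCons)
  \<comment> \<open>Left multiplication by \<open>U\<close> replaces the first row by \<open>(0, \<dots>, 0, p)\<close>.\<close>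
  define U where "U = mat n n (\<lambda>(i, j). if i = 0 then x ^ j else if i = j then 1 else 0)"
  have Uc: "U \<in> carrier_mat n n" by (simp add: U_def)
  have "det U = prod_list (diag_mat U)"
    by (rule det_upper_triangular[OF _ Uc]) (auto simp: upper_triangular_def U_def)
  also have "\<dots> = prod_list (map (\<lambda>_. 1) [0..<n])"
    unfolding diag_mat_def by (intro arg_cong[where f = prod_list] map_cong) (auto simp: U_def)
  also have "\<dots> = 1" by (induction n) auto
  finally have "det (U * B) = det B" using det_mult[OF Uc Bc] by simp
  define A where "A = U * B"
  have Ac: "A \<in> carrier_mat n n" using Uc Bc by (simp add: A_def)
  have A: "A $$ (i, j) = (\<Sum>k<n. U $$ (i, k) * B $$ (k, j))" if "i < n" "j < n" for i j
    using that Uc Bc by (simp add: A_def scalar_prod_def atLeast0LessThan)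
  have A_row: "A $$ (i, j) = B $$ (i, j)" if "0 < i" "i < n" "j < n" for i j
  proof -
    have "A $$ (i, j) = (\<Sum>k<n. if k = i then B $$ (k, j) else 0)"
      unfolding A[OF that(2,3)] using that by (intro sum.cong) (auto simp: U_def)
    then show ?thesis using that by simp
  qed
  \<comment> \<open>The diagonal \<open>x\<close> in row \<open>j\<close>, weighted by
    \<open>x^j\<close>, cancels the \<open>-1\<close> in row \<open>j + 1\<close>, weighted by
    \<open>x^(j+1)\<close>; the bound on \<open>j\<close> ensures that this row exists.\<close>
  have A_0: "A $$ (0, j) = 0" if j: "j < n - 1" for j
  proof -
    have "A $$ (0, j) = (\<Sum>k<n. x ^ k * B $$ (k, j))"
      using j by (auto simp: A U_def intro!: sum.cong)
    also have "\<dots> = (\<Sum>k<n. (if k = j then x ^ j * x else 0) + (if k = Suc j then - (x ^ Suc j) else 0))"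
      using j by (intro sum.cong) (auto simp: B)
    also have "\<dots> = 0" using j by (simp add: sum.distrib)
    finally show ?thesis .
  qed
  \<comment> \<open>The last column holds the coefficients of \<open>p\<close> below degree
    \<open>n\<close>; the extra diagonal \<open>x\<close> in its bottom entry supplies the leading
    term \<open>x^n\<close>.\<close>
  have A_last: "A $$ (0, n - 1) = p"
  proof -
    have "A $$ (0, n - 1) = (\<Sum>k<n. x ^ k * B $$ (k, n - 1))"
      using n by (auto simp: A U_def intro!: sum.cong)
    also have "\<dots> = (\<Sum>k<n. (if k = n - 1 then x ^ (n - 1) * x else 0) + x ^ k * [:coeff p k:])"
      using n by (intro sum.cong) (auto simp: B algebra_simps)
    also have "\<dots> = x ^ n + (\<Sum>k<n. x ^ k * [:coeff p k:])"
      using n power_minus_mult[of n x] by (simp add: sum.distrib)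
    also have "\<dots> = monom (coeff p n) n + (\<Sum>k<n. monom (coeff p k) k)"
      using deg monic by (simp add: x_def monom_altdef mult.commute)
    also have "\<dots> = (\<Sum>k\<le>degree p. monom (coeff p k) k)"
      by (simp add: deg lessThan_Suc_atMost[symmetric])
    finally show ?thesis by (simp add: poly_as_sum_of_monoms)
  qed
  have "det A = (\<Sum>j<n. A $$ (0, j) * cofactor A 0 j)"
    by (rule laplace_expansion_row[OF Ac]) (use n in simp)
  also have "\<dots> = (\<Sum>j<n. if j = n - 1 then p * cofactor A 0 (n - 1) else 0)"
    by (intro sum.cong) (use A_0 A_last in auto)
  also have "\<dots> = p * cofactor A 0 (n - 1)" using n by simp
  \<comment> \<open>The minor is upper triangular with diagonal entries \<open>-1\<close>, so its
    determinant cancels the cofactor sign \<open>(-1)^(n-1)\<close>.\<close>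
  also have "cofactor A 0 (n - 1) = 1"
  proof -
    define D where "D = mat_delete A 0 (n - 1)"
    have Dc: "D \<in> carrier_mat (n - 1) (n - 1)" using Ac mat_delete_dim[of A 0 "n - 1"] by (auto simp: D_def)
    have D: "D $$ (i, j) = B $$ (Suc i, j)" if "i < n - 1" "j < n - 1" for i j
      using that Ac by (simp add: D_def mat_delete_def A_row)
    have "det D = prod_list (diag_mat D)"
      by (rule det_upper_triangular[OF _ Dc])
        (use Dc in \<open>auto simp: upper_triangular_def D B\<close>)
    also have "\<dots> = prod_list (map (\<lambda>_. - 1) [0..<n - 1])"
      unfolding diag_mat_def using Dc
      by (intro arg_cong[where f = prod_list] map_cong) (auto simp: D B)
    also have "\<dots> = (- 1) ^ (n - 1)" by (simp add: map_replicate_const)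
    finally show ?thesis unfolding cofactor_def D_def[symmetric] by (simp flip: power_mult_distrib)
  qed
  finally have "det A = p" by simp
  then show ?thesis using \<open>det (U * B) = det B\<close> by (simp add: A_def B_def char_poly_def)
qed

text \<open>A matrix with this shape is the companion matrix of the monic \<open>q\<close> read off
  its last column with reversed sign, and \<open>q\<close> must then be its characteristic
  polynomial.\<close>

lemma companion_mat_if_char_poly:
  assumes n: "n \<ge> 1" and M: "M \<in> carrier_mat n n"
    and shift: "\<And>i j. i < n \<Longrightarrow> Suc j < n \<Longrightarrow> M $$ (i, j) = (if i = Suc j then 1 else 0)"
  shows "M = companion_mat n (char_poly M)"
proof -
  define q where "q = monom 1 n - (\<Sum>i<n. monom (M $$ (i, n - 1)) i)"
  have coeff_q: "coeff q k = (if k = n then 1 else if k < n then - M $$ (k, n - 1) else 0)" for k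
  proof -
    have "(\<Sum>i<n. coeff (monom (M $$ (i, n - 1)) i) k) = (\<Sum>i<n. if i = k then M $$ (k, n - 1) else 0)"
      by (intro sum.cong) auto
    then show ?thesis by (simp add: q_def coeff_sum)
  qed
  have deg: "degree q = n"
    by (rule antisym) (auto intro!: degree_le le_degree simp: coeff_q)
  have Mq: "M = companion_mat n q"
  proof (rule eq_matI)
    fix i j assume "i < dim_row (companion_mat n q)" "j < dim_col (companion_mat n q)"
    then have "i < n" "j < n" by (simp_all add: companion_mat_def)
    moreover have "Suc j < n" if "j \<noteq> n - 1" using that \<open>j < n\<close> by simp
    ultimately show "M $$ (i, j) = companion_mat n q $$ (i, j)"
      using shift by (auto simp: companion_mat_def coeff_q)
  qed (use M in \<open>simp_all add: companion_mat_def\<close>)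
  have "char_poly M = q"
    using char_poly_companion_mat[OF n deg] by (simp add: Mq deg coeff_q)
  then show ?thesis using Mq by simp
qed

lemma proots_linear_factors: "proots (\<Prod>z\<leftarrow>zs. [:- z, 1:]) = mset zs"
  for zs :: "'a :: idom list"
proof (induction zs)
  case (Cons z zs)
  have "(\<Prod>z\<leftarrow>zs. [:- z, 1:]) \<noteq> 0" by (auto simp: prod_list_zero_iff)
  then show ?case using Cons
    by (simp add: proots_mult del: mult_pCons_left)
qed simp

text \<open>Over the complex numbers the characteristic polynomial splits into monic linear factors,
  so its multiset of roots determines it; the embedding of real polynomials is injective.\<close>

lemma char_poly_eqI_proots:
  fixes M :: "real mat"
  assumes M: "M \<in> carrier_mat n n"
    and roots: "proots (map_poly complex_of_real (char_poly M)) = mset zs"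
    and p: "map_poly complex_of_real p = (\<Prod>z\<leftarrow>zs. [:- z, 1:])"
  shows "char_poly M = p"
proof -
  have "map_poly complex_of_real (char_poly M) = char_poly (map_mat complex_of_real M)"
    by (rule of_real_hom.char_poly_hom[OF M, symmetric])
  moreover obtain as where "char_poly (map_mat complex_of_real M) = (\<Prod>z\<leftarrow>as. [:- z, 1:])"
    using char_poly_factorized[of "map_mat complex_of_real M" n] M by auto
  ultimately have as: "map_poly complex_of_real (char_poly M) = (\<Prod>z\<leftarrow>as. [:- z, 1:])" by simp
  then have "mset as = mset zs" using roots by (simp add: proots_linear_factors)
  then have "(\<Prod>z\<leftarrow>as. [:- z, 1:]) = (\<Prod>z\<leftarrow>zs. [:- z, 1:])"
    by (metis mset_map prod_mset_prod_list)
  then have "map_poly complex_of_real (char_poly M) = map_poly complex_of_real p"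
    using as p by simp
  then show ?thesis by (simp add: poly_eq_iff coeff_map_poly)
qed

subsection \<open>Skew-Hamiltonian matrices\<close>

lemma J_mat_carrier [simp]: "J_mat n \<in> carrier_mat (2 * n) (2 * n)"
  unfolding J_mat_def mult_2 by (rule four_block_carrier_mat) auto

lemma J_mat_dim [simp]: "dim_row (J_mat n) = 2 * n" "dim_col (J_mat n) = 2 * n"
  using J_mat_carrier[of n] by (blast dest: carrier_matD)+

lemma transpose_J_mat: "transpose_mat (J_mat n) = - J_mat n"
  by (intro eq_matI) (auto simp: J_mat_def)

lemma J_mat_square: "J_mat n * J_mat n = - 1\<^sub>m (2 * n)"
proof -
  have "J_mat n * J_mat n = four_block_mat (- 1\<^sub>m n) (0\<^sub>m n n) (0\<^sub>m n n) (- 1\<^sub>m n)"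
    unfolding J_mat_def
    by (subst mult_four_block_mat[of _ n n _ n _ n _ _ n _ n])
      (auto intro!: arg_cong4[where f = four_block_mat] simp: mat_dim_simps)
  also have "\<dots> = - 1\<^sub>m (2 * n)" by (intro eq_matI) auto
  finally show ?thesis .
qed

text \<open>The form of \<open>J_mat_square\<close> that matches products nested to the right by
  \<open>mat_dim_simps\<close>.\<close>

lemma J_mat_J_mat_mult: "dim_row A = 2 * n \<Longrightarrow> J_mat n * (J_mat n * A) = - A"
  using arg_cong[OF J_mat_square, of "\<lambda>M. M * A" n] by (simp add: mat_dim_simps)

text \<open>As \<open>J^T = -J\<close> and \<open>J^2 = -1\<close>, the condition
  \<open>J^T H^T J = H\<close> is equivalent to \<open>H^T J = J H\<close>, and \<open>H^T J\<close>
  is \<open>-(J H)^T\<close>.\<close>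

lemma skew_hamiltonian_iff_skew:
  "skew_hamiltonian n H \<longleftrightarrow>
    H \<in> carrier_mat (2 * n) (2 * n) \<and> transpose_mat (J_mat n * H) = - (J_mat n * H)"
proof (cases "H \<in> carrier_mat (2 * n) (2 * n)")
  case True
  then have dims: "dim_row H = 2 * n" "dim_col H = 2 * n" by auto
  define K where "K = transpose_mat H * J_mat n"
  have K: "dim_row K = 2 * n" "dim_col K = 2 * n" using dims by (simp_all add: K_def)
  have "skew_hamiltonian n H \<longleftrightarrow> - (J_mat n * K) = H"
    using True K dims by (simp add: skew_hamiltonian_def K_def transpose_J_mat mat_dim_simps)
  also have "\<dots> \<longleftrightarrow> K = J_mat n * H"
  proof
    assume "- (J_mat n * K) = H"
    then have "J_mat n * H = - (J_mat n * (J_mat n * K))" using K by (auto simp: mat_dim_simps)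
    then show "K = J_mat n * H" using K by (simp add: J_mat_J_mat_mult)
  qed (use dims in \<open>simp add: J_mat_J_mat_mult\<close>)
  also have "\<dots> \<longleftrightarrow> transpose_mat (J_mat n * H) = - (J_mat n * H)"
    using dims by (simp add: K_def transpose_J_mat mat_dim_simps)
  finally show ?thesis using True by simp
qed (simp add: skew_hamiltonian_def)

lemma isotropic_J_mat:
  assumes "isotropic n L" and "set xs \<subseteq> L" and "X = mat_of_cols (2 * n) xs"
  shows "transpose_mat X * (J_mat n * X) = 0\<^sub>m (length xs) (length xs)"
proof (rule eq_matI)
  interpret V: vec_space "TYPE(real)" "2 * n" .
  have LV: "L \<subseteq> carrier_vec (2 * n)"
    using assms(1) submodule.subset[of class_ring L "real_space (2 * n)"]
    by (simp add: isotropic_def)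
  have X: "X \<in> carrier_mat (2 * n) (length xs)" using assms(3) by simp
  fix i j assume "i < dim_row (0\<^sub>m (length xs) (length xs) :: real mat)"
    "j < dim_col (0\<^sub>m (length xs) (length xs) :: real mat)"
  then have ij: "i < length xs" "j < length xs" by simp_all
  then have col: "col X i = xs ! i" "col X j = xs ! j" and mem: "xs ! i \<in> L" "xs ! j \<in> L"
    using assms(2,3) LV by (auto simp: subset_iff)
  have "col (J_mat n * X) j = J_mat n *\<^sub>v xs ! j"
    using col_mult2[OF J_mat_carrier X ij(2)] col by simp
  then have "(transpose_mat X * (J_mat n * X)) $$ (i, j) = xs ! i \<bullet> (J_mat n *\<^sub>v xs ! j)"
    using ij X col by simp
  then show "(transpose_mat X * (J_mat n * X)) $$ (i, j) =
      0\<^sub>m (length xs) (length xs) $$ (i, j)"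
    using assms(1) mem ij by (simp add: isotropic_def)
qed (use assms(3) in simp_all)

text \<open>
  A skew-Hamiltonian matrix shifting the basis maps all but the last basis vector into \<open>L\<close>, so by
  skew-symmetry only the last diagonal entry of \<open>X\<^sup>T J H X\<close> could be nonzero, and it vanishes, again
  by skew-symmetry.
\<close>
lemma HK_form_vanishes:
  assumes iso: "transpose_mat X * (J_mat n * X) = 0\<^sub>m n n"
    and X: "X = mat_of_cols (2 * n) xs" and xs: "set xs \<subseteq> carrier_vec (2 * n)" "length xs = n"
    and H: "H \<in> HK n xs"
  shows "transpose_mat X * (J_mat n * (H * X)) = 0\<^sub>m n n"
proof -
  have Xc: "X \<in> carrier_mat (2 * n) n" using X xs by auto
  have Hc: "H \<in> carrier_mat (2 * n) (2 * n)"
    and skew: "transpose_mat (J_mat n * H) = - (J_mat n * H)"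
    and shift: "\<And>k. Suc k < n \<Longrightarrow> H *\<^sub>v (xs ! k) = xs ! Suc k"
    using H by (auto simp: HK_def skew_hamiltonian_iff_skew)
  have dims: "dim_row X = 2 * n" "dim_col X = n" "dim_row H = 2 * n" "dim_col H = 2 * n"
    using Xc Hc by auto
  define G where "G = transpose_mat X * (J_mat n * (H * X))"
  have G: "G \<in> carrier_mat n n" using dims by (auto simp: G_def)
  have "G = transpose_mat X * ((J_mat n * H) * X)"
    using dims by (simp add: G_def mat_dim_simps)
  also have "transpose_mat \<dots> = transpose_mat X * (transpose_mat (J_mat n * H) * X)"
    using dims by (simp add: transpose_mult_dim assoc_mult_mat_dim)
  also have "\<dots> = - G"
    unfolding skew using dims by (simp add: G_def mat_dim_simps)
  finally have GT: "transpose_mat G = - G" .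
  have swap: "G $$ (i, j) = - G $$ (j, i)" if "i < n" "j < n" for i j
    using arg_cong[OF GT, of "\<lambda>M. M $$ (j, i)"] that G by simp
  have zero: "G $$ (i, j) = 0" if i: "i < n" and j: "Suc j < n" for i j
  proof -
    have "col X k = xs ! k" if "k < n" for k using that X xs by (auto simp: subset_iff)
    then have "col (H * X) j = col X (Suc j)"
      using shift[OF j] col_mult2[OF Hc Xc, of j] j by simp
    then have "col (J_mat n * (H * X)) j = col (J_mat n * X) (Suc j)"
      using col_mult2[OF J_mat_carrier, of "H * X" n n j] col_mult2[OF J_mat_carrier Xc, of "Suc j"]
        Hc Xc j by simp
    then have "G $$ (i, j) = (transpose_mat X * (J_mat n * X)) $$ (i, Suc j)"
      using i j dims by (simp add: G_def)
    then show ?thesis using iso i j by simp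
  qed
  have "G $$ (i, j) = 0" if ij: "i < n" "j < n" for i j
  proof -
    consider "Suc j < n" | "Suc i < n" | "i = j" using ij by linarith
    then show ?thesis using zero ij swap[of i j] by cases auto
  qed
  then show ?thesis unfolding G_def[symmetric] using G by (intro eq_matI) auto
qed

theorem theorem5:
  fixes n :: nat and L :: "real vec set" and xs :: "real vec list"
    and ls :: "complex list" and p :: "real poly" and Xperp H :: "real mat"
  defines "J \<equiv> J_mat n"
    and "X \<equiv> mat_of_cols (2 * n) xs"
    and "C \<equiv> companion_mat n p"
  defines "Htilde \<equiv> X * C * pseudoinverse X
      + transpose_mat J * transpose_mat (X * C * pseudoinverse X) * J"
  assumes "n \<ge> 1"
    and "lagrangian n L"
    and "ordered_basis (2 * n) L xs"
    and "length ls = n"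
    and "image_mset cnj (mset ls) = mset ls"
    and "map_poly complex_of_real p = (\<Prod>z\<leftarrow>ls. [:- z, 1:])"
    and "Xperp \<in> carrier_mat (2 * n) n"
    and "ordered_basis (2 * n) (vec_module.orthogonal_complement (2 * n) L) (cols Xperp)"
    and "orthonormal (cols Xperp)"
    and "H \<in> HK n xs"
    and "restr_eigenvalues (2 * n) H L = mset ls"
  shows "\<exists>S \<in> carrier_mat n n. transpose_mat S = - S \<and>
    H = Htilde + transpose_mat J * Xperp * S * transpose_mat Xperp"
proof -
  define P where "P = pseudoinverse X"
  define Q where "Q = Xperp"
  have iso: "isotropic n L" and dimL: "subspace_dim (2 * n) L = n"
    using \<open>lagrangian n L\<close> by (auto simp: lagrangian_def)
  have L: "linear_subspace (2 * n) L" using iso by (simp add: isotropic_def)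
  note basis = \<open>ordered_basis (2 * n) L xs\<close>
  have len: "length xs = n" using ordered_basis_length[OF L basis] dimL by simp
  have xsL: "set xs \<subseteq> L" using basis ordered_basis_iff[OF L] by blast
  have Xc: "X \<in> carrier_mat (2 * n) n" using mat_of_cols_carrier(1)[of "2 * n" xs] by (simp add: X_def len)
  note inj = ordered_basis_coords(3)[OF L basis, folded X_def, unfolded len]
  have PX: "P * X = 1\<^sub>m n" and Pc: "P \<in> carrier_mat n (2 * n)"
    using pseudoinverse_full_column_rank[OF Xc inj] Xc by (auto simp: P_def is_pseudoinverse_def)
  have Qc: "Q \<in> carrier_mat (2 * n) n" using assms by (simp add: Q_def)
  note proj = projections_onto_complements[OF L basis X_def[THEN meta_eq_to_obj_eq] Qc
      assms(12,13)[folded Q_def], unfolded len, folded P_def]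
  have Hc: "H \<in> carrier_mat (2 * n) (2 * n)"
    and skewH: "transpose_mat (J * H) = - (J * H)"
    and shift: "\<And>k. Suc k < n \<Longrightarrow> H *\<^sub>v (xs ! k) = xs ! Suc k"
    using \<open>H \<in> HK n xs\<close> by (auto simp: HK_def skew_hamiltonian_iff_skew J_def)
  have Cc: "C \<in> carrier_mat n n" by (simp add: C_def companion_mat_def)
  have dims: "dim_row X = 2 * n" "dim_col X = n" "dim_row P = n" "dim_col P = 2 * n"
    "dim_row Q = 2 * n" "dim_col Q = n" "dim_row H = 2 * n" "dim_col H = 2 * n"
    "dim_row C = n" "dim_col C = n" "dim_row J = 2 * n" "dim_col J = 2 * n"
    using Xc Pc Qc Hc Cc by (auto simp: J_def)
  have JT: "transpose_mat J = - J" by (simp add: J_def transpose_J_mat)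
  have JJ: "J * (J * A) = - A" if "dim_row A = 2 * n" for A
    unfolding J_def by (rule J_mat_J_mat_mult[OF that])
  have XJX: "transpose_mat X * (J * X) = 0\<^sub>m n n"
    using isotropic_J_mat[OF iso xsL X_def[THEN meta_eq_to_obj_eq]] len by (simp add: J_def)
  have XJHX: "transpose_mat X * (J * (H * X)) = 0\<^sub>m n n"
    unfolding J_def
    by (rule HK_form_vanishes[OF XJX[unfolded J_def] X_def[THEN meta_eq_to_obj_eq]
        ordered_basis_coords(1)[OF L basis] len \<open>H \<in> HK n xs\<close>])

  \<comment> \<open>Invariance of \<open>L\<close> under \<open>H\<close>\<close>
  have "transpose_mat Q * (H * X) = 0\<^sub>m n n"
  proof -
    define W where "W = transpose_mat Q * (J * X)"
    have W: "W \<in> carrier_mat n n" using dims by (auto simp: W_def)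
    \<comment> \<open>Isotropy puts the columns of \<open>J X\<close> into the complement. Once the
      square matrix \<open>W\<close> is known to be invertible,
      \<open>W^T Q^T H X = (J X)^T H X = - X^T J H X = 0\<close> yields the claim.\<close>
    have JX: "J * X = Q * W"
      unfolding W_def by (rule proj(3)[OF _ XJX]) (use dims in auto)
    have "det W \<noteq> 0"
    proof (rule det_nonzero_if_injective[OF W])
      fix c :: "real vec" assume c: "c \<in> carrier_vec n" and Wc: "W *\<^sub>v c = 0\<^sub>v n"
      \<comment> \<open>Factoring \<open>X\<close> through \<open>W\<close> shows that
        \<open>W c = 0\<close> forces \<open>X c = 0\<close>, hence \<open>c = 0\<close> by
        independence of the basis.\<close>
      have "X = - (J * (Q * W))" using JJ[of X] dims JX by simp
      also have "\<dots> = - (J * Q) * W" using dims W by (simp add: mat_dim_simps)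
      finally have "X *\<^sub>v c = - (J * Q) *\<^sub>v (W *\<^sub>v c)"
        using assoc_mult_mat_vec[of "- (J * Q)" "2 * n" n W n c] W c dims by (metis carrier_matI
          index_mult_mat(2,3) index_uminus_mat(2,3))
      also have "\<dots> = 0\<^sub>v (2 * n)" unfolding Wc
        using dims by (auto simp: scalar_prod_def intro!: eq_vecI)
      finally show "c = 0\<^sub>v n" by (rule inj[OF c])
    qed
    then have "det (transpose_mat W) \<noteq> 0" using det_transpose[OF W] by simp
    then obtain V where V: "V \<in> carrier_mat n n" "V * transpose_mat W = 1\<^sub>m n"
      using obtain_inverse_mat[of "transpose_mat W" n] W by auto
    have "transpose_mat W * (transpose_mat Q * (H * X)) = transpose_mat (Q * W) * (H * X)"
      using dims W by (simp add: mat_dim_simps)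
    also have "\<dots> = - (transpose_mat X * (J * (H * X)))"
      unfolding JX[symmetric] using dims by (simp add: mat_dim_simps JT)
    also have "\<dots> = 0\<^sub>m n n" unfolding XJHX by (intro eq_matI) auto
    finally have "V * (transpose_mat W * (transpose_mat Q * (H * X))) = 0\<^sub>m n n"
      using V by simp
    moreover have "V * (transpose_mat W * (transpose_mat Q * (H * X))) =
        (V * transpose_mat W) * (transpose_mat Q * (H * X))"
      using V(1) W dims by (simp add: mat_dim_simps)
    ultimately show ?thesis using V dims by (simp add: mat_dim_simps)
  qed

  \<comment> \<open>The matrix of the restriction is the companion matrix\<close>
  then have "H * X = X * (P * (H * X))"
    using arg_cong[OF proj(2), of "\<lambda>M. M * (H * X)"] dims by (simp add: mat_dim_simps)
  moreover define M where "M = P * (H * X)"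
  ultimately have HX: "H * X = X * M" by simp
  have M: "M \<in> carrier_mat n n" using dims by (auto simp: M_def)
  \<comment> \<open>Column \<open>j\<close> of \<open>H X\<close> is column \<open>j + 1\<close> of
    \<open>X\<close>, which \<open>P\<close> sends to a standard basis vector since
    \<open>P X = 1\<close>.\<close>
  have M_col: "M $$ (i, j) = (if i = Suc j then 1 else 0)" if i: "i < n" and j: "Suc j < n" for i j
  proof -
    have "col X k = xs ! k" if "k < n" for k
      using that ordered_basis_coords(1)[OF L basis] len by (auto simp: X_def subset_iff)
    then have "col (H * X) j = col X (Suc j)"
      using shift[OF j] col_mult2[OF Hc Xc, of j] j by simp
    then have "M $$ (i, j) = (P * X) $$ (i, Suc j)" using i j dims by (simp add: M_def)
    then show ?thesis using PX i j by simp
  qed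
  have "restr_char_poly (2 * n) H L = char_poly M"
    using restr_char_poly_eqI[OF L Hc basis] M HX by (simp add: len X_def)
  then have "char_poly M = p"
    using \<open>restr_eigenvalues (2 * n) H L = mset ls\<close> char_poly_eqI_proots[OF M _ assms(10)]
    by (simp add: restr_eigenvalues_def)
  then have HX: "H * X = X * C"
    using companion_mat_if_char_poly[OF \<open>n \<ge> 1\<close> M M_col] HX by (simp add: C_def)

  \<comment> \<open>The skew-symmetric difference between \<open>H\<close> and
    \<open>Htilde\<close>\<close>
  define K where "K = X * (C * P)"
  have K: "dim_row K = 2 * n" "dim_col K = 2 * n" using dims by (simp_all add: K_def)
  have Ht: "Htilde = K - J * (transpose_mat K * J)"
  proof -
    have "Htilde = K + - (J * (transpose_mat K * J))"
      using dims by (simp add: Htilde_def K_def P_def[symmetric] JT mat_dim_simps)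
    then show ?thesis using K dims by (auto intro: eq_matI)
  qed
  define D where "D = J * H - J * Htilde"
  \<comment> \<open>The two summands are negative transposes of each other, which makes
    \<open>J * Htilde\<close> skew-symmetric.\<close>
  have JHt: "J * Htilde = J * K + transpose_mat K * J"
    unfolding Ht using K dims JJ[of "transpose_mat K * J"] by (auto simp: mat_dim_simps intro: eq_matI)
  have D: "dim_row D = 2 * n" "dim_col D = 2 * n" using dims K by (simp_all add: D_def Ht)
  have DT: "transpose_mat D = - D"
  proof -
    have "transpose_mat (J * Htilde) = - (J * Htilde)"
      unfolding JHt using K dims
      by (subst transpose_add[of _ "2 * n" "2 * n"]) (auto simp: mat_dim_simps JT intro: eq_matI)
    moreover have "transpose_mat D = transpose_mat (J * H) - transpose_mat (J * Htilde)"
      unfolding D_def by (rule transpose_minus[of _ "2 * n" "2 * n"]) (use dims Ht K in auto)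
    ultimately show ?thesis
      unfolding D_def skewH using dims K by (auto simp: Ht intro: eq_matI)
  qed
  \<comment> \<open>Both matrices act on \<open>L\<close> as \<open>C\<close>:
    \<open>K X = X C\<close> because \<open>P X = 1\<close>, and the correction term of
    \<open>Htilde\<close> vanishes on \<open>L\<close> because it contains
    \<open>X^T J X = 0\<close>.\<close>
  have DX: "D * X = 0\<^sub>m (2 * n) n"
  proof -
    have KX: "K * X = X * C" using dims PX by (simp add: K_def mat_dim_simps)
    have "transpose_mat K * (J * X) =
        transpose_mat P * (transpose_mat C * (transpose_mat X * (J * X)))"
      using dims by (simp add: K_def mat_dim_simps)
    also have "\<dots> = 0\<^sub>m (2 * n) n" unfolding XJX using dims by (simp add: mat_dim_simps)
    finally have "J * Htilde * X = J * (X * C)"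
      unfolding JHt using K dims KX by (simp add: mat_dim_simps)
    moreover have "J * H * X = J * (X * C)" using HX dims by (simp add: mat_dim_simps)
    ultimately show ?thesis
      using dims K by (auto simp: D_def Ht minus_mult_distrib_mat_dim intro: eq_matI)
  qed
  have DQ: "D = D * (Q * transpose_mat Q)"
  proof -
    have "D = D * (X * P + Q * transpose_mat Q)" unfolding proj(2) using D by (simp add: mat_dim_simps)
    also have "\<dots> = D * X * P + D * (Q * transpose_mat Q)" using D dims by (simp add: mat_dim_simps)
    also have "\<dots> = D * (Q * transpose_mat Q)" unfolding DX using D dims by (simp add: mat_dim_simps)
    finally show ?thesis .
  qed
  \<comment> \<open>Transposing \<open>DQ\<close> and cancelling the sign from skew-symmetry moves
    the projection to the left side.\<close>
  have "D = Q * transpose_mat Q * D"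
    using arg_cong[OF DQ, of transpose_mat] D dims DT by (simp add: mat_dim_simps)
  then have DQQ: "D = Q * (transpose_mat Q * D * Q) * transpose_mat Q"
    using DQ D dims by (simp add: mat_dim_simps)
  define S where "S = transpose_mat Q * D * Q"
  have S: "S \<in> carrier_mat n n" using dims by (auto simp: S_def)
  have ST: "transpose_mat S = - S" using D dims DT by (simp add: S_def mat_dim_simps)
  \<comment> \<open>\<open>J^2 = -1\<close> undoes the factor \<open>J\<close> in \<open>D\<close>;
    the remaining sign is absorbed by \<open>J^T = -J\<close>.\<close>
  have "J * D = Htilde - H"
    using dims K JJ[of H] JJ[of Htilde] by (auto simp: D_def Ht mult_minus_distrib_mat_dim intro: eq_matI)
  then have "H = Htilde + - (J * D)"
    using dims K by (auto simp: Ht intro: eq_matI)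
  also have "- (J * D) = transpose_mat J * Q * S * transpose_mat Q"
    using arg_cong[OF DQQ[folded S_def], of "\<lambda>M. - (J * M)"] dims S by (simp add: JT mat_dim_simps)
  finally show ?thesis using S ST by (auto simp: Q_def)
qed

end
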